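(* Let $k$ and $n$ be positive integers. Let $d_1,\dots,d_r$ be the positive divisors of $k$ whose $2$-adic valuation equals that of $k$, and let $$S_k(n)=\left\{(a_1,\dots,a_r)\in\mathbb{Z}_{\ge0}^r \;:\; \sum_{i=1}^r a_id_i=\left\lfloor \tfrac n2\right\rfloor\right\}.$$ Then the number of $\pi\in\mathcal{S}_n$ such that $\pi^k$ is the decreasing permutation $w_0$ (given by $w_0(i)=n+1-i$) is $$\sum_{(a_1,\dots,a_r)\in S_k(n)}\frac{\lfloor n/2\rfloor!\cdot\prod_{i=1}^r 2^{a_i(d_i-1)}}{\prod_{i=1}^r a_i!\,d_i^{a_i}}.$$
   Context: $\mathcal{S}_n$ is the symmetric group on $[n]=\{1,\dots,n\}$. The $2$-adic valuation of a positive integer is the exponent of $2$ in its prime factorization. *)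

theory Defs
  imports
    Complex_Main
    "HOL-Combinatorics.Permutations"
    "HOL-Computational_Algebra.Primes"
    "HOL-Library.FuncSet"
begin

text \<open>
  Elements of the symmetric group on \<open>{1..n}\<close> are functions \<open>p :: nat \<Rightarrow> nat\<close> with
  \<open>p permutes {1..n}\<close>, which in particular fix every point outside \<open>{1..n}\<close>; \<open>w0\<close> follows the
  same convention, and \<open>p ^^ k\<close> is the group power.
\<close>

definition w0 :: "nat \<Rightarrow> nat \<Rightarrow> nat" where
  "w0 n = (\<lambda>i. if i \<in> {1..n} then n + 1 - i else i)"

definition divisors_same_val2 :: "nat \<Rightarrow> nat set" where
  "divisors_same_val2 k = {d. 0 < d \<and> d dvd k \<and> multiplicity 2 d = multiplicity 2 k}"

text \<open>
  The set \<open>S\<^sub>k(n)\<close>, relative to the enumeration \<open>d 1, \<dots>, d r\<close> of \<open>divisors_same_val2 k\<close>.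
  An \<open>r\<close>-tuple is a function that is extensional outside \<open>{1..r}\<close>, so that distinct
  elements of the set are distinct tuples.
\<close>

definition S_set :: "nat \<Rightarrow> (nat \<Rightarrow> nat) \<Rightarrow> nat \<Rightarrow> (nat \<Rightarrow> nat) set" where
  "S_set r d n = {a \<in> {1..r} \<rightarrow>\<^sub>E UNIV. (\<Sum>i=1..r. a i * d i) = n div 2}"

text \<open>
  Each \<open>S_set r d n\<close> with positive \<open>d i\<close> is finite, so a sum ranging over it is not the
  default value 0 that infinite index sets yield.
\<close>

lemma finite_S_set:
  assumes "\<And>i. i \<in> {1..r} \<Longrightarrow> 0 < d i"
  shows "finite (S_set r d n)"
proof (rule finite_subset)
  show "S_set r d n \<subseteq> {1..r} \<rightarrow>\<^sub>E {..n div 2}"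
  proof
    fix a assume a: "a \<in> S_set r d n"
    have "a i \<le> n div 2" if i: "i \<in> {1..r}" for i
    proof -
      have "a i \<le> a i * d i" using assms[OF i] by simp
      also have "\<dots> \<le> (\<Sum>i=1..r. a i * d i)"
        using i by (intro member_le_sum) auto
      also have "\<dots> = n div 2" using a by (simp add: S_set_def)
      finally show ?thesis .
    qed
    with a show "a \<in> {1..r} \<rightarrow>\<^sub>E {..n div 2}"
      by (auto simp: S_set_def PiE_iff)
  qed
qed (intro finite_PiE; simp)

end

theory Submission
  imports Defs "HOL-Combinatorics.Cycles"
begin

text \<open>
  If \<open>p ^^ k = w0\<close>, the cycle of \<open>p\<close> through a point \<open>x\<close> moved by \<open>w0\<close> has even length \<open>2 * d\<close>, where
  \<open>d\<close> divides \<open>k\<close> with odd quotient, and it reads \<open>xs @ map w0 xs\<close> with \<open>xs\<close> of length \<open>d\<close>.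
  With \<open>2 * m\<close> moved points there are \<open>2 ^ (d - 1) * (m - 1)! / (m - d)!\<close> such lists \<open>xs\<close> starting
  at \<open>x\<close>, and deleting the cycle leaves a root on the remaining \<open>2 * (m - d)\<close> points. Hence the
  number \<open>F m\<close> of roots satisfies \<open>F m = (m - 1)! * (\<Sum>d. 2 ^ (d - 1) * F (m - d) / (m - d)!)\<close>. The
  right-hand side of the theorem satisfies the same recurrence.
\<close>

section \<open>Iterates of maps, and divisors of \<open>k\<close> with odd quotient\<close>

lemma funpow_closed: "(\<And>y. y \<in> A \<Longrightarrow> f y \<in> A) \<Longrightarrow> x \<in> A \<Longrightarrow> (f ^^ j) x \<in> A"
  by (induction j) auto

lemma funpow_cong_on:
  assumes "\<And>y. y \<in> B \<Longrightarrow> f y = g y" "\<And>y. y \<in> B \<Longrightarrow> g y \<in> B" "x \<in> B"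
  shows "(f ^^ j) x = (g ^^ j) x"
proof (induction j)
  case (Suc j)
  have "(g ^^ j) x \<in> B" using assms(2,3) by (rule funpow_closed)
  with Suc assms(1) show ?case by simp
qed simp

text \<open>Valuations add along \<open>k = d * q\<close>, so equal valuations of \<open>d\<close>
  and \<open>k\<close> leave valuation 0 for \<open>q\<close>. The odd quotient is the form in which
  cycle lengths meet this condition.\<close>

lemma divisors_same_val2_iff:
  assumes "k > 0"
  shows "d \<in> divisors_same_val2 k \<longleftrightarrow> (\<exists>q. odd q \<and> k = d * q)"
proof -
  have "multiplicity 2 d = multiplicity 2 k \<longleftrightarrow> odd q" if k: "k = d * q" for q
  proof -
    have "d \<noteq> 0" "q \<noteq> 0" using assms k by auto
    then have "multiplicity 2 k = multiplicity 2 d + multiplicity 2 q"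
      unfolding k by (intro prime_elem_multiplicity_mult_distrib) auto
    moreover have "multiplicity 2 q = 0 \<longleftrightarrow> odd q"
      using \<open>q \<noteq> 0\<close> by (subst multiplicity_eq_zero_iff) auto
    ultimately show ?thesis by auto
  qed
  then show ?thesis using assms unfolding divisors_same_val2_def by (auto elim!: dvdE)
qed

lemma divisors_same_val2_pos: "d \<in> divisors_same_val2 k \<Longrightarrow> 0 < d"
  by (simp add: divisors_same_val2_def)

lemma finite_divisors_same_val2: "k > 0 \<Longrightarrow> finite (divisors_same_val2 k)"
  by (rule finite_subset[of _ "{..k}"]) (auto simp: divisors_same_val2_def dvd_imp_le)

text \<open>In \<open>2 * k = L * s\<close> an even \<open>s\<close> would give
  \<open>L dvd k\<close>. So \<open>s\<close> is odd, \<open>L\<close> is even, and \<open>s\<close>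
  is the odd quotient of \<open>k\<close> by half of \<open>L\<close>. The intended \<open>L\<close>
  is the length of a cycle that the exponent \<open>2 * k\<close> closes and \<open>k\<close> does
  not.\<close>

lemma dvd_double_not_dvd:
  fixes k L :: nat
  assumes "k > 0" "L dvd 2 * k" "\<not> L dvd k"
  obtains d where "L = 2 * d" "d \<in> divisors_same_val2 k"
proof -
  from assms(2) obtain s where s: "2 * k = L * s" by (elim dvdE)
  have "odd s"
  proof
    assume "even s"
    then obtain t where "s = 2 * t" by (elim evenE)
    then have "k = L * t" using s by simp
    then show False using assms(3) by simp
  qed
  then have "even L" using s by (metis dvd_triv_left even_mult_iff)
  then obtain d where d: "L = 2 * d" by (elim evenE)
  then have "k = d * s" using s by simp
  then show thesis using that d \<open>odd s\<close> divisors_same_val2_iff assms(1) by blast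
qed

section \<open>Fixed-point-free involutions and the choice of half cycles\<close>

definition fpf_involution_on :: "'a set \<Rightarrow> ('a \<Rightarrow> 'a) \<Rightarrow> bool" where
  "fpf_involution_on A w \<longleftrightarrow> (\<forall>x\<in>A. w x \<in> A \<and> w x \<noteq> x \<and> w (w x) = x)"

text \<open>The equation with \<open>w\<close> is required on \<open>A\<close> only, so the same
  \<open>w\<close> can be kept while \<open>A\<close> shrinks by deletion of cycles.\<close>

definition perm_roots :: "nat \<Rightarrow> 'a set \<Rightarrow> ('a \<Rightarrow> 'a) \<Rightarrow> ('a \<Rightarrow> 'a) set" where
  "perm_roots k A w = {p. p permutes A \<and> (\<forall>x\<in>A. (p ^^ k) x = w x)}"

text \<open>These are the candidates for the first half of a cycle. For a fixed-point-free
  involution \<open>w\<close>, distinctness means that the entries lie in pairwise different pairs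
  \<open>{x, w x}\<close>.\<close>

definition half_orbit_lists :: "'a set \<Rightarrow> ('a \<Rightarrow> 'a) \<Rightarrow> nat \<Rightarrow> 'a list set" where
  "half_orbit_lists A w e = {xs. length xs = e \<and> set xs \<subseteq> A \<and> distinct (xs @ map w xs)}"

lemma fpf_involution_on_Diff:
  assumes "fpf_involution_on A w" "set xs \<subseteq> A"
  shows "fpf_involution_on (A - set (xs @ map w xs)) w"
  unfolding fpf_involution_on_def
proof
  fix x assume x: "x \<in> A - set (xs @ map w xs)"
  with assms(1) have w: "w x \<in> A" "w x \<noteq> x" "w (w x) = x"
    by (auto simp: fpf_involution_on_def)
  have "w x \<notin> set xs" using x w(3) by (metis DiffD2 UnCI image_eqI list.set_map set_append)
  moreover have "w x \<noteq> w y" if "y \<in> set xs" for y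
    using that x assms w(3) unfolding fpf_involution_on_def
    by (metis DiffD2 UnCI set_append subsetD)
  ultimately show "w x \<in> A - set (xs @ map w xs) \<and> w x \<noteq> x \<and> w (w x) = x"
    using w by auto
qed

lemma finite_half_orbit_lists: "finite A \<Longrightarrow> finite (half_orbit_lists A w e)"
  by (rule finite_subset[OF _ finite_lists_length_eq[of A e]]) (auto simp: half_orbit_lists_def)

text \<open>On \<open>A\<close> the map \<open>w\<close> is injective and swaps \<open>x\<close>
  with \<open>w x\<close>, so every clash between the head and the tail comes from an entry
  \<open>x\<close> or \<open>w x\<close> in the tail.\<close>

lemma half_orbit_lists_Cons_iff:
  assumes "fpf_involution_on A w"
  shows "x # xs \<in> half_orbit_lists A w (Suc e) \<longleftrightarrow>
    x \<in> A \<and> xs \<in> half_orbit_lists (A - {x, w x}) w e"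
proof -
  have "w x \<noteq> x" "\<And>y. y \<in> A \<Longrightarrow> w y = x \<longleftrightarrow> y = w x" "\<And>y. y \<in> A \<Longrightarrow> w y = w x \<longleftrightarrow> y = x"
    if "x \<in> A" using assms that by (auto simp: fpf_involution_on_def) metis+
  then show ?thesis unfolding half_orbit_lists_def by fastforce
qed

lemma half_orbit_lists_hd:
  assumes "fpf_involution_on A w" "x \<in> A"
  shows "{xs \<in> half_orbit_lists A w (Suc e). hd xs = x} =
    Cons x ` half_orbit_lists (A - {x, w x}) w e"
proof -
  have "xs \<in> half_orbit_lists A w (Suc e) \<and> hd xs = x \<longleftrightarrow>
      xs \<in> Cons x ` half_orbit_lists (A - {x, w x}) w e" for xs
    using half_orbit_lists_Cons_iff[OF assms(1)] assms(2)
    by (cases xs) (auto simp: half_orbit_lists_def[of A])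
  then show ?thesis by blast
qed

lemma fpf_involution_on_Diff_pair:
  assumes "fpf_involution_on A w" "x \<in> A"
  shows "fpf_involution_on (A - {x, w x}) w"
  using fpf_involution_on_Diff[of A w "[x]"] assms by (simp add: insert_commute)

lemma card_Diff_pair:
  assumes "fpf_involution_on A w" "x \<in> A" "finite A"
  shows "card (A - {x, w x}) = card A - 2"
proof -
  have "card {x, w x} = 2" "{x, w x} \<subseteq> A" using assms(1,2) by (auto simp: fpf_involution_on_def)
  then show ?thesis by (simp add: card_Diff_subset)
qed

text \<open>There are \<open>2 * m\<close> choices for the first entry, \<open>2 * (m - 1)\<close>
  for the next, and so on, because each choice uses up a pair. The denominator of
  \<open>2 ^ e * fact m / fact (m - e)\<close> is cleared to stay in the natural numbers.\<close>

lemma card_half_orbit_lists: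
  assumes "fpf_involution_on A w" "finite A" "card A = 2 * m" "e \<le> m"
  shows "card (half_orbit_lists A w e) * fact (m - e) = 2 ^ e * fact m"
  using assms
proof (induction e arbitrary: A m)
  case 0
  have "half_orbit_lists A w 0 = {[]}" by (auto simp: half_orbit_lists_def)
  then show ?case by simp
next
  case (Suc e)
  obtain m' where m: "m = Suc m'" using Suc.prems(4) by (cases m) auto
  have IH: "card (half_orbit_lists (A - {x, w x}) w e) * fact (m' - e) = 2 ^ e * fact m'" if "x \<in> A" for x
    using that Suc.prems m card_Diff_pair[of A w x] fpf_involution_on_Diff_pair[of A w x]
    by (intro Suc.IH) auto
  have eq: "half_orbit_lists A w (Suc e) =
      (\<lambda>(x, xs). x # xs) ` (SIGMA x:A. half_orbit_lists (A - {x, w x}) w e)" (is "_ = _ ` ?S")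
  proof (intro set_eqI)
    fix xs
    show "xs \<in> half_orbit_lists A w (Suc e) \<longleftrightarrow> xs \<in> (\<lambda>(x, xs). x # xs) ` ?S"
      using half_orbit_lists_Cons_iff[OF Suc.prems(1), of "hd xs" "tl xs"]
      by (cases xs) (auto simp: half_orbit_lists_def[of A])
  qed
  have "card (half_orbit_lists A w (Suc e)) = card ?S"
    unfolding eq by (intro card_image inj_onI) auto
  also have "\<dots> = (\<Sum>x\<in>A. card (half_orbit_lists (A - {x, w x}) w e))"
    using Suc.prems(2) by (intro card_SigmaI ballI finite_half_orbit_lists) auto
  finally have "card (half_orbit_lists A w (Suc e)) * fact (m - Suc e) =
      (\<Sum>x\<in>A. card (half_orbit_lists (A - {x, w x}) w e) * fact (m' - e))"
    by (simp add: m sum_distrib_right)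
  also have "\<dots> = card A * (2 ^ e * fact m')" using IH by simp
  finally show ?case using Suc.prems(3) by (simp add: m algebra_simps)
qed

section \<open>Cycles of roots, and the recurrence from deleting one cycle\<close>

lemma card_perm_roots_prescribed:
  assumes "B \<subseteq> A" "c permutes B" and ck: "\<And>y. y \<in> B \<Longrightarrow> (c ^^ k) y = w y"
  shows "card {p \<in> perm_roots k A w. \<forall>y\<in>B. p y = c y} = card (perm_roots k (A - B) w)"
\<comment> \<open>Composing with \<open>inv c\<close> cancels the prescribed part: \<open>p\<close>
  becomes the identity on \<open>B\<close> and is unchanged on \<open>A - B\<close>.\<close>
proof (rule bij_betw_same_card[OF bij_betw_byWitness[where f = "\<lambda>p. inv c \<circ> p" and f' = "\<lambda>p. c \<circ> p"]])
  let ?L = "{p \<in> perm_roots k A w. \<forall>y\<in>B. p y = c y}"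
  let ?R = "perm_roots k (A - B) w"
  note cinv = permutes_inverses[OF assms(2)] and cB = permutes_in_image[OF assms(2)]
  note cout = permutes_not_in[OF assms(2)] and ciout = permutes_not_in[OF permutes_inv[OF assms(2)]]
  have q: "inv c \<circ> p permutes A - B" if "p permutes A" "\<forall>y\<in>B. p y = c y" for p
  proof (rule permutes_superset)
    show "inv c \<circ> p permutes A"
      using that(1) permutes_subset[OF permutes_inv[OF assms(2)] assms(1)] by (rule permutes_compose)
    show "(inv c \<circ> p) x = x" if "x \<in> A - (A - B)" for x
      using that \<open>\<forall>y\<in>B. p y = c y\<close> cinv by auto
  qed
  \<comment> \<open>A point of \<open>A - B\<close> is not sent into \<open>B\<close> by
    \<open>p\<close>, and \<open>inv c\<close> is the identity off \<open>B\<close>, so both maps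
    have the same iterates there.\<close>
  have outside: "(p ^^ k) y = ((inv c \<circ> p) ^^ k) y"
    if p: "p permutes A" "\<forall>y\<in>B. p y = c y" and "y \<in> A - B" for p y
  proof (rule funpow_cong_on[OF _ _ that(3)])
    fix y assume y: "y \<in> A - B"
    show qy: "(inv c \<circ> p) y \<in> A - B" using permutes_in_image[OF q[OF p]] y by blast
    have "p y \<notin> B"
    proof
      assume "p y \<in> B"
      then have "inv c (p y) \<in> B" using permutes_in_image[OF permutes_inv[OF assms(2)]] by blast
      with qy show False by auto
    qed
    then show "p y = (inv c \<circ> p) y" using ciout by simp
  qed
  show "\<forall>p\<in>?L. c \<circ> (inv c \<circ> p) = p" using cinv by (auto simp: fun_eq_iff)
  show "\<forall>p\<in>?R. inv c \<circ> (c \<circ> p) = p" using cinv by (auto simp: fun_eq_iff)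
  show "(\<lambda>p. inv c \<circ> p) ` ?L \<subseteq> ?R"
  proof safe
    fix p assume p: "p \<in> perm_roots k A w" "\<forall>y\<in>B. p y = c y"
    then have pA: "p permutes A" by (simp add: perm_roots_def)
    from q[OF this p(2)]
    show "inv c \<circ> p \<in> ?R" using p outside[OF pA p(2)] by (auto simp: perm_roots_def)
  qed
  show "(\<lambda>p. c \<circ> p) ` ?R \<subseteq> ?L"
  proof safe
    fix p assume p: "p \<in> ?R"
    then have pAB: "p permutes A - B" by (simp add: perm_roots_def)
    then have pB: "p y = y" if "y \<in> B" for y using that permutes_not_in by fastforce
    have "p permutes A" using pAB by (rule permutes_subset) auto
    then have cp: "c \<circ> p permutes A"
      using permutes_subset[OF assms(2,1)] by (rule permutes_compose)
    show agree: "(c \<circ> p) y = c y" if "y \<in> B" for y using pB[OF that] by simp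
    have "((c \<circ> p) ^^ k) y = w y" if "y \<in> A" for y
    proof (cases "y \<in> B")
      case True
      have "((c \<circ> p) ^^ k) y = (c ^^ k) y"
        using agree cB True by (intro funpow_cong_on[of B]) auto
      then show ?thesis using ck True by simp
    next
      case False
      have "inv c \<circ> (c \<circ> p) = p" using cinv by (auto simp: fun_eq_iff)
      then have "((c \<circ> p) ^^ k) y = (p ^^ k) y"
        using outside[OF cp, of y] agree that False by simp
      then show ?thesis using p that False by (auto simp: perm_roots_def)
    qed
    with cp show "c \<circ> p \<in> perm_roots k A w" by (simp add: perm_roots_def)
  qed
qed

text \<open>Since \<open>p ^^ (2 * k)\<close> fixes \<open>x\<close> and \<open>p ^^ k\<close> moves
  it, the cycle length is \<open>2 * d\<close> with \<open>k\<close> an odd multiple of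
  \<open>d\<close>. Half a turn of the cycle then acts as \<open>w\<close>, so the second half of
  the cycle is the \<open>w\<close>-image of the first.\<close>

lemma support_perm_root:
  assumes "finite A" "fpf_involution_on A w" "k > 0" "p \<in> perm_roots k A w" "x \<in> A"
  obtains xs where "support p x = xs @ map w xs" "hd xs = x"
    "length xs \<in> divisors_same_val2 k" "xs \<in> half_orbit_lists A w (length xs)"
proof -
  let ?L = "least_power p x"
  have p: "p permutes A" and pk: "\<And>y. y \<in> A \<Longrightarrow> (p ^^ k) y = w y"
    using assms(4) by (auto simp: perm_roots_def)
  have perm: "permutation p" using p assms(1) permutation_permutes by blast
  have inA: "(p ^^ i) x \<in> A" for i
    using permutes_in_image[OF permutes_funpow[OF p]] assms(5) by blast
  have wx: "w x \<in> A" "w x \<noteq> x" "w (w x) = x" using assms(2,5) by (auto simp: fpf_involution_on_def)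
  have "(p ^^ (2 * k)) x = x" using pk wx assms(5) by (simp add: mult_2 funpow_add)
  then have "?L dvd 2 * k" using least_power_dvd[OF perm] by blast
  moreover have "\<not> ?L dvd k" using least_power_dvd[OF perm] pk wx assms(5) by metis
  ultimately obtain d where d: "?L = 2 * d" "d \<in> divisors_same_val2 k"
    using dvd_double_not_dvd assms(3) by blast
  then obtain q where "odd q" and kq: "k = d * q" using divisors_same_val2_iff[OF assms(3)] by blast
  then obtain j where "q = Suc (2 * j)" by (metis oddE Suc_eq_plus1)
  \<comment> \<open>\<open>k\<close> exceeds \<open>d\<close> by whole turns of the cycle, so
    \<open>p ^^ d\<close> and \<open>p ^^ k\<close> agree at \<open>x\<close>.\<close>
  with kq d(1) have kL: "k = d + ?L * j" by (simp add: algebra_simps)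
  have "(p ^^ (?L * j)) x = x" using least_power_dvd[OF perm] by (metis dvd_triv_left)
  then have pd: "(p ^^ d) x = w x"
    using pk[OF assms(5)] unfolding kL by (simp add: funpow_add)
  \<comment> \<open>On \<open>A\<close> the map \<open>w\<close> is \<open>p ^^ k\<close>, which
    commutes with every power of \<open>p\<close>. This carries the equation at \<open>x\<close> to
    the whole cycle.\<close>
  have shift: "(p ^^ (i + d)) x = w ((p ^^ i) x)" for i
  proof -
    have "(p ^^ (i + d)) x = (p ^^ i) ((p ^^ k) x)"
      using pd pk[OF assms(5)] by (simp add: funpow_add)
    also have "\<dots> = (p ^^ (k + i)) x" by (subst add.commute) (simp add: funpow_add)
    also have "\<dots> = (p ^^ k) ((p ^^ i) x)" by (simp add: funpow_add)
    finally show ?thesis using pk inA by simp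
  qed
  define xs where "xs = map (\<lambda>i. (p ^^ i) x) [0..<d]"
  have "support p x = xs @ map (\<lambda>i. (p ^^ i) x) [d..<d + d]"
    unfolding d(1) xs_def mult_2 using upt_add_eq_append[of 0 d d] by simp
  also have "map (\<lambda>i. (p ^^ i) x) [d..<d + d] = map w xs"
    unfolding xs_def using shift by (intro nth_equalityI) (auto simp: add.commute)
  finally have supp: "support p x = xs @ map w xs" .
  have "distinct (xs @ map w xs)" using cycle_of_permutation[OF perm, of x] unfolding supp .
  then have "xs \<in> half_orbit_lists A w (length xs)"
    using inA by (auto simp: half_orbit_lists_def xs_def)
  moreover have "hd xs = x" using divisors_same_val2_pos[OF d(2)] by (simp add: xs_def hd_map)
  ultimately show thesis using that[OF supp] d(2) by (simp add: xs_def)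
qed

text \<open>This turns a condition on the cycle through \<open>x\<close> into prescribed values on a
  set, as \<open>card_perm_roots_prescribed\<close> requires. Conversely, values prescribed along
  \<open>zs\<close> make the iterates of \<open>x\<close> run through \<open>zs\<close>
  periodically.\<close>

lemma support_eq_iff_cycle_of_list:
  assumes "permutation p" "distinct zs" "zs \<noteq> []" "hd zs = x"
  shows "support p x = zs \<longleftrightarrow> (\<forall>y\<in>set zs. p y = cycle_of_list zs y)"
proof
  assume "support p x = zs"
  then show "\<forall>y\<in>set zs. p y = cycle_of_list zs y"
    using cycle_restrict[OF assms(1)] by blast
next
  let ?L = "least_power p x" and ?l = "length zs"
  assume agree: "\<forall>y\<in>set zs. p y = cycle_of_list zs y"
  have pow: "(p ^^ j) x = zs ! (j mod ?l)" for j
  proof -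
    have x: "x = zs ! 0" using assms(3,4) by (simp add: hd_conv_nth)
    have "(p ^^ j) x = (cycle_of_list zs ^^ j) x"
      using agree permutes_in_image[OF cycle_permutes[of zs]] assms(3,4)
      by (intro funpow_cong_on[of "set zs"]) auto
    also have "\<dots> = map (cycle_of_list zs ^^ j) zs ! 0" using assms(3) by (simp add: x)
    also have "\<dots> = zs ! (j mod ?l)"
      unfolding cyclic_rotation[OF assms(2)] using assms(3) by (subst nth_rotate) auto
    finally show ?thesis .
  qed
  have "(p ^^ j) x = x \<longleftrightarrow> ?l dvd j" for j
    using pow[of j] pow[of 0] assms(2,3)
    by (simp add: nth_eq_iff_index_eq dvd_eq_mod_eq_0)
  \<comment> \<open>\<open>?L\<close> and \<open>?l\<close> divide the same exponents, namely those
    that return \<open>x\<close> to itself, so each divides the other.\<close>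
  then have "?L = ?l" using least_power_dvd[OF assms(1)] by (metis dvd_antisym dvd_refl)
  then show "support p x = zs" using pow by (intro nth_equalityI) auto
qed

text \<open>Modulo the cycle length \<open>2 * d\<close> the exponent \<open>k\<close> is
  \<open>d\<close>, so the \<open>k\<close>-th power of the cycle \<open>xs @ map w xs\<close> swaps
  its two halves. That is \<open>w\<close> on these points, so the cycle is a root there and can be
  split off.\<close>

lemma card_perm_roots_support:
  assumes "finite A" "fpf_involution_on A w" "k > 0"
    "d \<in> divisors_same_val2 k" "xs \<in> half_orbit_lists A w d"
  shows "card {p \<in> perm_roots k A w. support p (hd xs) = xs @ map w xs} =
    card (perm_roots k (A - set (xs @ map w xs)) w)"
proof -
  let ?zs = "xs @ map w xs"
  have xs: "length xs = d" "set xs \<subseteq> A" "distinct ?zs" "?zs \<noteq> []" "hd ?zs = hd xs"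
    using assms(5) divisors_same_val2_pos[OF assms(4)] by (auto simp: half_orbit_lists_def)
  have w: "w y \<in> A" "w (w y) = y" if "y \<in> A" for y
    using assms(2) that by (auto simp: fpf_involution_on_def)
  obtain q where "odd q" and kq: "k = d * q" using divisors_same_val2_iff assms(3,4) by blast
  then obtain j where "q = Suc (2 * j)" by (metis oddE Suc_eq_plus1)
  then have "k = d + length ?zs * j" using xs(1) kq by (simp add: algebra_simps)
  then have kd: "k mod length ?zs = d mod length ?zs" by (simp only: mod_mult_self2)
  have "map (cycle_of_list ?zs ^^ k) ?zs = rotate (k mod length ?zs) ?zs"
    unfolding cyclic_rotation[OF xs(3)] by (rule rotate_conv_mod)
  also have "\<dots> = rotate d ?zs" unfolding kd by (rule rotate_conv_mod[symmetric])
  also have "\<dots> = map w xs @ xs" using rotate_append[of xs "map w xs"] xs(1) by simp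
  \<comment> \<open>Applying \<open>w\<close> to the second half \<open>map w xs\<close> gives back
    \<open>xs\<close>, since \<open>w\<close> is an involution on \<open>A\<close>.\<close>
  also have "\<dots> = map w ?zs" using w(2) xs(2) by (auto simp: map_idI subset_iff)
  finally have "map (cycle_of_list ?zs ^^ k) ?zs = map w ?zs" .
  then have ck: "(cycle_of_list ?zs ^^ k) y = w y" if "y \<in> set ?zs" for y
    using that unfolding map_eq_conv by (rule bspec)
  have "{p \<in> perm_roots k A w. support p (hd xs) = ?zs} =
      {p \<in> perm_roots k A w. \<forall>y\<in>set ?zs. p y = cycle_of_list ?zs y}"
    using support_eq_iff_cycle_of_list[OF _ xs(3-5)] assms(1) permutation_permutes
    unfolding perm_roots_def by blast
  also have "card \<dots> = card (perm_roots k (A - set ?zs) w)"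
    using xs(2) w(1) ck by (intro card_perm_roots_prescribed cycle_permutes) auto
  finally show ?thesis .
qed

text \<open>Roots are sorted by the first half \<open>xs\<close> of the cycle through one chosen
  point, and these lists by their length \<open>d\<close>. The function \<open>g\<close> is a root
  count divided by a factorial; its factor \<open>fact (m - d)\<close> cancels against the count of
  lists. Assumption \<open>N\<close> holds the place of the induction hypothesis.\<close>

lemma card_perm_roots_rec:
  assumes A: "finite A" "fpf_involution_on A w" "card A = 2 * m" "m > 0" and k: "k > 0"
    and N: "\<And>B d. d \<in> divisors_same_val2 k \<Longrightarrow> d \<le> m \<Longrightarrow> finite B \<Longrightarrow> fpf_involution_on B w \<Longrightarrow>
      card B = 2 * (m - d) \<Longrightarrow> real (card (perm_roots k B w)) = fact (m - d) * g (m - d)"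
  shows "real (card (perm_roots k A w)) =
    fact (m - 1) * (\<Sum>d\<in>{d\<in>divisors_same_val2 k. d \<le> m}. 2 ^ (d - 1) * g (m - d))"
proof -
  obtain x where x: "x \<in> A" using A(3,4) by (cases "A = {}") auto
  let ?D = "{d\<in>divisors_same_val2 k. d \<le> m}"
  let ?X = "\<lambda>d. {xs \<in> half_orbit_lists A w d. hd xs = x}"
  let ?R = "\<lambda>xs. {p \<in> perm_roots k A w. support p x = xs @ map w xs}"
  have finR: "finite (?R xs)" for xs
    by (rule finite_subset[OF _ finite_permutations[OF A(1)]]) (auto simp: perm_roots_def)
  have disj: "?R xs \<inter> ?R ys = {}" if "xs \<noteq> ys" for xs ys
  proof -
    have "xs @ map w xs \<noteq> ys @ map w ys"
    proof
      assume eq: "xs @ map w xs = ys @ map w ys"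
      \<comment> \<open>Each side is twice as long as its first half, so both are cut at the same
        position.\<close>
      from arg_cong[OF this, of length] have "length xs = length ys" by simp
      with eq that show False by simp
    qed
    then show ?thesis by auto
  qed
  have finX: "finite (?X d)" for d using finite_half_orbit_lists[OF A(1)] by simp
  have finD: "finite ?D" using finite_divisors_same_val2[OF k] by simp
  have len: "length xs = d" if "xs \<in> half_orbit_lists A w d" for xs d
    using that by (simp add: half_orbit_lists_def)
  have card_set: "card (set (xs @ map w xs)) = 2 * d" and sub: "set (xs @ map w xs) \<subseteq> A"
    if "xs \<in> half_orbit_lists A w d" for xs d
  proof -
    have xs: "length xs = d" "set xs \<subseteq> A" "distinct (xs @ map w xs)"
      using that by (auto simp: half_orbit_lists_def)
    show "card (set (xs @ map w xs)) = 2 * d" using distinct_card[OF xs(3)] xs(1) by simp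
    show "set (xs @ map w xs) \<subseteq> A" using xs(2) A(2) by (auto simp: fpf_involution_on_def)
  qed
  have partition: "perm_roots k A w = (\<Union>d\<in>?D. \<Union>xs\<in>?X d. ?R xs)"
  proof (intro equalityI subsetI)
    fix p assume p: "p \<in> perm_roots k A w"
    then obtain xs where xs: "support p x = xs @ map w xs" "hd xs = x"
      "length xs \<in> divisors_same_val2 k" "xs \<in> half_orbit_lists A w (length xs)"
      using support_perm_root A(1,2) k x by metis
    \<comment> \<open>The cycle has to fit into \<open>A\<close>, which gives the bound
      \<open>d \<le> m\<close>.\<close>
    have "2 * length xs \<le> card A" using card_mono[OF A(1) sub[OF xs(4)]] card_set[OF xs(4)] by simp
    then have "length xs \<in> ?D" using A(3) xs(3) by simp
    with p xs show "p \<in> (\<Union>d\<in>?D. \<Union>xs\<in>?X d. ?R xs)" by blast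
  qed blast
  have "card (perm_roots k A w) = card (\<Union>d\<in>?D. \<Union>xs\<in>?X d. ?R xs)"
    using partition by (rule arg_cong)
  also have "\<dots> = (\<Sum>d\<in>?D. card (\<Union>xs\<in>?X d. ?R xs))"
  proof (rule card_UN_disjoint[OF finD]; intro ballI impI)
    show "finite (\<Union>xs\<in>?X d. ?R xs)" for d using finX finR by (rule finite_UN_I)
    fix d e :: nat assume "d \<noteq> e"
    have "?R xs \<inter> ?R ys = {}" if "xs \<in> ?X d" "ys \<in> ?X e" for xs ys
    proof (rule disj)
      show "xs \<noteq> ys" using that len[of xs d] len[of ys e] \<open>d \<noteq> e\<close> by auto
    qed
    then show "(\<Union>xs\<in>?X d. ?R xs) \<inter> (\<Union>xs\<in>?X e. ?R xs) = {}" by blast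
  qed
  also have "\<dots> = (\<Sum>d\<in>?D. \<Sum>xs\<in>?X d. card (?R xs))"
  proof (rule sum.cong[OF refl], rule card_UN_disjoint[OF finX])
    show "\<forall>xs\<in>?X d. finite (?R xs)" for d using finR by (rule ballI)
    show "\<forall>xs\<in>?X d. \<forall>ys\<in>?X d. xs \<noteq> ys \<longrightarrow> ?R xs \<inter> ?R ys = {}" for d
      by (rule ballI, rule ballI, rule impI, rule disj)
  qed
  finally have "real (card (perm_roots k A w)) = (\<Sum>d\<in>?D. \<Sum>xs\<in>?X d. real (card (?R xs)))"
    by simp
  also have "\<dots> = (\<Sum>d\<in>?D. fact (m - 1) * (2 ^ (d - 1) * g (m - d)))"
  proof (rule sum.cong[OF refl])
    fix d assume d: "d \<in> ?D"
    then have "d > 0" using divisors_same_val2_pos by auto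
    then obtain e where e: "d = Suc e" by (cases d) auto
    have R: "real (card (?R xs)) = fact (m - d) * g (m - d)" if xs: "xs \<in> ?X d" for xs
    proof -
      have "card (?R xs) = card (perm_roots k (A - set (xs @ map w xs)) w)"
        using card_perm_roots_support[OF A(1,2) k, of d xs] d xs by auto
      moreover have "fpf_involution_on (A - set (xs @ map w xs)) w"
        using fpf_involution_on_Diff[OF A(2)] sub xs by auto
      moreover have "card (A - set (xs @ map w xs)) = 2 * (m - d)"
        using card_Diff_subset[OF _ sub, of xs d] card_set[of xs d] xs A(3)
        by (simp add: diff_mult_distrib2 del: set_append)
      ultimately show ?thesis using N d A(1) by simp
    qed
    \<comment> \<open>With the head fixed as \<open>x\<close>, the other \<open>e = d - 1\<close>
      entries come from the \<open>m - 1\<close> remaining pairs; note that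
      \<open>m - 1 - e = m - d\<close>.\<close>
    have "card (?X d) = card (half_orbit_lists (A - {x, w x}) w e)"
      unfolding e half_orbit_lists_hd[OF A(2) x] by (rule card_image) auto
    moreover have "card (half_orbit_lists (A - {x, w x}) w e) * fact (m - 1 - e) = 2 ^ e * fact (m - 1)"
      using fpf_involution_on_Diff_pair[OF A(2) x] card_Diff_pair[OF A(2) x A(1)] A d e
      by (intro card_half_orbit_lists) (auto simp: diff_mult_distrib2)
    ultimately have "card (?X d) * fact (m - d) = 2 ^ (d - 1) * fact (m - 1)" by (simp add: e)
    from arg_cong[OF this, of real]
    have X: "real (card (?X d)) * fact (m - d) = 2 ^ (d - 1) * fact (m - 1)" by simp
    have "(\<Sum>xs\<in>?X d. real (card (?R xs))) = real (card (?X d)) * fact (m - d) * g (m - d)"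
      using R by simp
    then show "(\<Sum>xs\<in>?X d. real (card (?R xs))) = fact (m - 1) * (2 ^ (d - 1) * g (m - d))"
      unfolding X by simp
  qed
  finally show ?thesis by (simp add: sum_distrib_left)
qed

section \<open>Removal of the middle point fixed by \<open>w0\<close>\<close>

lemma perm_roots_w0:
  "{p. p permutes {1..n} \<and> p ^^ k = w0 n} = perm_roots k {i \<in> {1..n}. 2 * i \<noteq> n + 1} (w0 n)"
  (is "?L = perm_roots k ?A _")
proof (intro equalityI subsetI)
  fix p assume "p \<in> ?L"
  then have p: "p permutes {1..n}" "p ^^ k = w0 n" by auto
  \<comment> \<open>\<open>p\<close> commutes with its power \<open>w0 n\<close> and so permutes the
    fixed points of \<open>w0 n\<close> in \<open>{1..n}\<close>. There is at most one, the solution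
    of \<open>2 * i = n + 1\<close>.\<close>
  have "p i = i" if i: "i \<in> {1..n} - ?A" for i
  proof -
    have "w0 n i = i" using i by (auto simp: w0_def)
    then have "w0 n (p i) = p i" unfolding p(2)[symmetric] by (metis funpow_swap1)
    moreover have "p i \<in> {1..n}" using permutes_in_image[OF p(1)] i by blast
    ultimately have "2 * p i = n + 1" by (auto simp: w0_def)
    then show ?thesis using i by auto
  qed
  then have "p permutes ?A" by (rule permutes_superset[OF p(1)])
  then show "p \<in> perm_roots k ?A (w0 n)" using p(2) by (simp add: perm_roots_def)
next
  fix p assume "p \<in> perm_roots k ?A (w0 n)"
  then have p: "p permutes ?A" "\<And>i. i \<in> ?A \<Longrightarrow> (p ^^ k) i = w0 n i" by (auto simp: perm_roots_def)
  have "(p ^^ k) i = w0 n i" for i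
  proof (cases "i \<in> ?A")
    case False
    then have "w0 n i = i" by (auto simp: w0_def)
    with permutes_not_in[OF permutes_funpow[OF p(1)] False] show ?thesis by simp
  qed (use p in blast)
  then have "p ^^ k = w0 n" ..
  moreover have "p permutes {1..n}" using p(1) by (rule permutes_subset) auto
  ultimately show "p \<in> ?L" by simp
qed

lemma fpf_involution_on_w0: "fpf_involution_on {i \<in> {1..n}. 2 * i \<noteq> n + 1} (w0 n)"
  by (auto simp: fpf_involution_on_def w0_def)

lemma card_non_middle: "card {i \<in> {1..n}. 2 * i \<noteq> n + 1} = 2 * (n div 2)"
proof (cases "even n")
  case True
  then have "{i \<in> {1..n}. 2 * i \<noteq> n + 1} = {1..n}" by auto presburger
  then show ?thesis using True by simp
next
  case False
  then obtain m where n: "n = 2 * m + 1" by (elim oddE)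
  then have "{i \<in> {1..n}. 2 * i \<noteq> n + 1} = {1..n} - {m + 1}" by auto
  then show ?thesis by (simp add: n)
qed

section \<open>The sum over solutions and its recurrence\<close>

definition weighted_solutions :: "'i set \<Rightarrow> ('i \<Rightarrow> nat) \<Rightarrow> nat \<Rightarrow> ('i \<Rightarrow> nat) set" where
  "weighted_solutions I d m = {a \<in> I \<rightarrow>\<^sub>E UNIV. (\<Sum>i\<in>I. a i * d i) = m}"

lemma finite_weighted_solutions:
  assumes "finite I" "\<And>i. i \<in> I \<Longrightarrow> 0 < d i"
  shows "finite (weighted_solutions I d m)"
proof (rule finite_subset)
  show "weighted_solutions I d m \<subseteq> I \<rightarrow>\<^sub>E {..m}"
  proof
    fix a assume a: "a \<in> weighted_solutions I d m"
    have "a i \<le> m" if i: "i \<in> I" for i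
    proof -
      have "a i \<le> a i * d i" using assms(2)[OF i] by simp
      also have "\<dots> \<le> (\<Sum>i\<in>I. a i * d i)"
        using i assms(1) by (intro member_le_sum) auto
      also have "\<dots> = m" using a by (simp add: weighted_solutions_def)
      finally show ?thesis .
    qed
    with a show "a \<in> I \<rightarrow>\<^sub>E {..m}"
      by (auto simp: weighted_solutions_def PiE_iff)
  qed
qed (use assms in \<open>auto intro!: finite_PiE\<close>)

text \<open>For finite \<open>I\<close> and positive \<open>d i\<close> this is the coefficient of
  \<open>x ^ m\<close> in \<open>exp (\<Sum>i\<in>I. c i * x ^ d i)\<close>. With
  \<open>c i = 2 ^ (d i - 1) / d i\<close> it becomes the sum of the theorem without its factorial
  \<open>fact (n div 2)\<close>.\<close>

definition cycle_index_coeff :: "'i set \<Rightarrow> ('i \<Rightarrow> nat) \<Rightarrow> ('i \<Rightarrow> real) \<Rightarrow> nat \<Rightarrow> real" where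
  "cycle_index_coeff I d c m =
     (\<Sum>a\<in>weighted_solutions I d m. \<Prod>i\<in>I. c i ^ a i / fact (a i))"

text \<open>The factor \<open>a i\<close> cancels against \<open>fact (a i)\<close> and leaves
  \<open>c i\<close> times the term with \<open>a i\<close> lowered by one; the lowering reduces the
  weighted sum by \<open>d i\<close>.\<close>

lemma sum_weighted_solutions_shift:
  assumes I: "finite I" "i \<in> I" and pos: "\<And>i. i \<in> I \<Longrightarrow> 0 < d i"
  shows "(\<Sum>a\<in>weighted_solutions I d m. real (a i) * (\<Prod>j\<in>I. c j ^ a j / fact (a j))) =
    (if d i \<le> m then c i * cycle_index_coeff I d c (m - d i) else 0)"
proof -
  let ?T = "\<lambda>a. \<Prod>j\<in>I. c j ^ a j / fact (a j) :: real"
  let ?S = "weighted_solutions I d"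
  let ?up = "\<lambda>a. a(i := Suc (a i))"
  have fin: "finite (?S m)" using finite_weighted_solutions I(1) pos by blast
  have split: "(\<Sum>j\<in>I. a j * d j) = a i * d i + (\<Sum>j\<in>I-{i}. a j * d j)" for a :: "_ \<Rightarrow> nat"
    using I by (simp add: sum.remove)
  have up: "(\<Sum>j\<in>I. ?up a j * d j) = d i + (\<Sum>j\<in>I. a j * d j)" for a
    by (simp add: split)
  \<comment> \<open>Terms with \<open>a i = 0\<close> vanish, so truncated subtraction does no harm
    when \<open>a i\<close> is lowered.\<close>
  have restrict: "(\<Sum>a\<in>?S m. real (a i) * ?T a) = (\<Sum>a\<in>{a\<in>?S m. a i > 0}. real (a i) * ?T a)"
    by (rule sum.mono_neutral_right) (use fin in auto)
  show ?thesis
  proof (cases "d i \<le> m")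
    case False
    have "d i \<le> m" if "a \<in> ?S m" "a i > 0" for a
    proof -
      have "d i \<le> a i * d i" using that(2) by simp
      also have "\<dots> \<le> m" using that(1) by (auto simp: weighted_solutions_def split)
      finally show ?thesis .
    qed
    with False have "{a\<in>?S m. a i > 0} = {}" by auto
    with False show ?thesis unfolding restrict by (simp only: sum.empty if_False)
  next
    case True
    have T: "real (Suc (a i)) * ?T (?up a) = c i * ?T a" for a
    proof -
      have "?T (?up a) = c i ^ Suc (a i) / fact (Suc (a i)) * (\<Prod>j\<in>I-{i}. c j ^ a j / fact (a j))"
        using I by (simp add: prod.remove)
      moreover have "?T a = c i ^ a i / fact (a i) * (\<Prod>j\<in>I-{i}. c j ^ a j / fact (a j))"
        using I by (simp add: prod.remove)
      ultimately show ?thesis by (simp del: of_nat_Suc)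
    qed
    have "(\<Sum>a\<in>{a\<in>?S m. a i > 0}. real (a i) * ?T a) = (\<Sum>a\<in>?S (m - d i). c i * ?T a)"
    proof (rule sum.reindex_bij_witness[where i = ?up and j = "\<lambda>a. a(i := a i - 1)"])
      fix a assume a: "a \<in> {a\<in>?S m. a i > 0}"
      then show eq: "?up (a(i := a i - 1)) = a" by (auto simp: fun_eq_iff)
      show "a(i := a i - 1) \<in> ?S (m - d i)"
        using a up[of "a(i := a i - 1)"] I(2) unfolding eq
        by (auto simp: weighted_solutions_def PiE_iff extensional_def)
      show "c i * ?T (a(i := a i - 1)) = real (a i) * ?T a"
        using T[of "a(i := a i - 1)"] a unfolding eq by auto
    next
      fix a assume a: "a \<in> ?S (m - d i)"
      show "(?up a)(i := ?up a i - 1) = a" by auto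
      show "?up a \<in> {a\<in>?S m. a i > 0}"
        using a up[of a] I(2) True by (auto simp: weighted_solutions_def PiE_iff extensional_def simp del: fun_upd_apply) auto
    qed
    then show ?thesis using restrict True by (simp add: cycle_index_coeff_def sum_distrib_left)
  qed
qed

text \<open>This is the logarithmic derivative of the generating function \<open>exp (\<Sum>i\<in>I. c i * x ^ d i)\<close>.\<close>

lemma cycle_index_coeff_rec:
  assumes I: "finite I" and pos: "\<And>i. i \<in> I \<Longrightarrow> 0 < d i"
  shows "real m * cycle_index_coeff I d c m =
    (\<Sum>i\<in>{i\<in>I. d i \<le> m}. real (d i) * c i * cycle_index_coeff I d c (m - d i))"
proof -
  let ?T = "\<lambda>a. \<Prod>j\<in>I. c j ^ a j / fact (a j) :: real"
  have "real m * cycle_index_coeff I d c m =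
    (\<Sum>a\<in>weighted_solutions I d m. (\<Sum>i\<in>I. real (d i) * (real (a i) * ?T a)))"
    unfolding cycle_index_coeff_def sum_distrib_left
  proof (rule sum.cong)
    fix a assume "a \<in> weighted_solutions I d m"
    \<comment> \<open>The constraint on \<open>a\<close> splits the factor \<open>m\<close> into one
      contribution for each index.\<close>
    then have "real m = (\<Sum>i\<in>I. real (a i) * real (d i))"
      by (auto simp: weighted_solutions_def)
    then show "real m * ?T a = (\<Sum>i\<in>I. real (d i) * (real (a i) * ?T a))"
      by (simp add: sum_distrib_left sum_distrib_right mult_ac)
  qed simp
  also have "\<dots> = (\<Sum>i\<in>I. real (d i) * (\<Sum>a\<in>weighted_solutions I d m. real (a i) * ?T a))"
    by (subst sum.swap) (simp add: sum_distrib_left)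
  also have "\<dots> = (\<Sum>i\<in>I. if d i \<le> m then real (d i) * c i * cycle_index_coeff I d c (m - d i) else 0)"
    using sum_weighted_solutions_shift[OF I _ pos] by (intro sum.cong) auto
  finally show ?thesis by (simp add: sum.inter_filter I)
qed

lemma cycle_index_coeff_0:
  assumes "finite I" and pos: "\<And>i. i \<in> I \<Longrightarrow> 0 < d i"
  shows "cycle_index_coeff I d c 0 = 1"
proof -
  have "weighted_solutions I d 0 = {\<lambda>i\<in>I. 0}"
    using assms by (fastforce simp: weighted_solutions_def PiE_iff extensional_def)
  then show ?thesis by (simp add: cycle_index_coeff_def)
qed

section \<open>Comparison of the two recurrences\<close>

lemma card_perm_roots:
  assumes k: "k > 0" and I: "finite I" and d: "bij_betw d I (divisors_same_val2 k)"
    and A: "finite A" "fpf_involution_on A w" "card A = 2 * m"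
  shows "real (card (perm_roots k A w)) =
    fact m * cycle_index_coeff I d (\<lambda>i. 2 ^ (d i - 1) / real (d i)) m"
  using A
proof (induction m arbitrary: A rule: less_induct)
  case (less m)
  have pos: "0 < d i" if "i \<in> I" for i
    using divisors_same_val2_pos bij_betwE[OF d] that by blast
  let ?g = "cycle_index_coeff I d (\<lambda>i. 2 ^ (d i - 1) / real (d i))"
  show ?case
  proof (cases "m = 0")
    case True
    then have "A = {}" using less.prems by simp
    then have "perm_roots k A w = {id}" by (auto simp: perm_roots_def)
    then show ?thesis using True cycle_index_coeff_0[OF I pos] by simp
  next
    case False
    have "real (card (perm_roots k A w)) =
        fact (m - 1) * (\<Sum>e\<in>{e\<in>divisors_same_val2 k. e \<le> m}. 2 ^ (e - 1) * ?g (m - e))"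
    proof (rule card_perm_roots_rec[OF less.prems _ k])
      fix B e assume "e \<in> divisors_same_val2 k"
        and B: "finite B" "fpf_involution_on B w" "card B = 2 * (m - e)"
      then have "m - e < m" using divisors_same_val2_pos False by (simp add: diff_less)
      then show "real (card (perm_roots k B w)) = fact (m - e) * ?g (m - e)"
        using B by (rule less.IH)
    qed (use False in simp)
    also have "(\<Sum>e\<in>{e\<in>divisors_same_val2 k. e \<le> m}. 2 ^ (e - 1) * ?g (m - e)) =
        (\<Sum>i\<in>{i\<in>I. d i \<le> m}. 2 ^ (d i - 1) * ?g (m - d i))"
    proof (rule sum.reindex_bij_betw[symmetric])
      show "bij_betw d {i \<in> I. d i \<le> m} {e \<in> divisors_same_val2 k. e \<le> m}"
        using d by (auto simp: bij_betw_def inj_on_def)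
    qed
    \<comment> \<open>The weight is chosen so that \<open>d i * c i = 2 ^ (d i - 1)\<close>, which
      matches the right-hand side of \<open>cycle_index_coeff_rec\<close>. The factor
      \<open>m\<close> then completes \<open>fact (m - 1)\<close> to \<open>fact m\<close>.\<close>
    also have "\<dots> = real m * ?g m"
      using pos by (subst cycle_index_coeff_rec[OF I]) (auto intro!: sum.cong)
    finally show ?thesis using False by (simp add: fact_reduce[of m])
  qed
qed

theorem theorem1p5:
  fixes k n r :: nat and d :: "nat \<Rightarrow> nat"
  assumes "k > 0" and "n > 0"
    and "bij_betw d {1..r} (divisors_same_val2 k)"
  shows "real (card {p. p permutes {1..n} \<and> p ^^ k = w0 n}) =
    (\<Sum>a\<in>S_set r d n.
       (fact (n div 2) * (\<Prod>i=1..r. 2 ^ (a i * (d i - 1)))) /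
       (\<Prod>i=1..r. fact (a i) * real (d i) ^ a i))"
proof -
  let ?I = "{1..r}"
  \<comment> \<open>Without the middle point, if there is one, \<open>n div 2\<close> pairs remain,
    so \<open>m\<close> becomes \<open>n div 2\<close>.\<close>
  have "real (card {p. p permutes {1..n} \<and> p ^^ k = w0 n}) =
      fact (n div 2) * cycle_index_coeff ?I d (\<lambda>i. 2 ^ (d i - 1) / real (d i)) (n div 2)"
    unfolding perm_roots_w0
    by (rule card_perm_roots[OF assms(1) _ assms(3) _ fpf_involution_on_w0 card_non_middle]) auto
  also have "\<dots> = (\<Sum>a\<in>S_set r d n.
      fact (n div 2) * (\<Prod>i=1..r. (2 ^ (d i - 1) / real (d i)) ^ a i / fact (a i)))"
    by (simp add: cycle_index_coeff_def weighted_solutions_def S_set_def sum_distrib_left)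
  also have "\<dots> = (\<Sum>a\<in>S_set r d n.
       (fact (n div 2) * (\<Prod>i=1..r. 2 ^ (a i * (d i - 1)))) /
       (\<Prod>i=1..r. fact (a i) * real (d i) ^ a i))"
  proof (rule sum.cong[OF refl])
    fix a
    have "(\<Prod>i=1..r. (2 ^ (d i - 1) / real (d i)) ^ a i / fact (a i)) =
        (\<Prod>i=1..r. 2 ^ (a i * (d i - 1)) / (fact (a i) * real (d i) ^ a i))"
      by (intro prod.cong refl) (simp add: power_divide mult.commute flip: power_mult)
    then show "fact (n div 2) * (\<Prod>i=1..r. (2 ^ (d i - 1) / real (d i)) ^ a i / fact (a i)) =
       (fact (n div 2) * (\<Prod>i=1..r. 2 ^ (a i * (d i - 1)))) /
       (\<Prod>i=1..r. fact (a i) * real (d i) ^ a i)"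
      by (simp add: prod_dividef)
  qed
  finally show ?thesis .
qed

end
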